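(* Let $\mathbb{F}$ be a finite field with $q$ elements and let $n\ge 1$ be an integer. Then the following hold. (a) If $n>2$, then $TD(\mathbb{F},n)$ is a semi-regular graph with degrees $q^{n-1}-1$ and $q^{n-1}-2$. (b) If $n=2$ and $q\equiv 3 \pmod 4$, then $TD(\mathbb{F},n)$ is a regular graph of valency $q-1$. (c) If $n=2$ and $q\equiv 1\pmod 4$, then $TD(\mathbb{F},n)$ is a semi-regular graph with degrees $q-1$ and $q-2$. (d) If $n=2$ and $\mathrm{char}(\mathbb{F})=2$, then $TD(\mathbb{F},n)$ is a semi-regular graph with degrees $q-1$ and $q-2$. (e) If $n=1$, then $TD(\mathbb{F},n)$ is the empty graph (no edges) on $q-1$ vertices.
   Context: For a commutative ring $R$ with nonzero identity and an integer $n\ge1$, $TD(R,n)$ is the simple graph with vertex set $R^n\setminus\{(0,\ldots,0)\}$ in which two distinct vertices $\mathbf{x},\mathbf{y}$ are adjacent if and only if $\mathbf{x}\cdot\mathbf{y}=\sum_{i=1}^n x_iy_i=0$ in $R$. A graph is semi-regular with degrees $d_1$ and $d_2$ (where $d_1\ne d_2$) if the set of its vertex degrees is exactly $\{d_1,d_2\}$. *)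

theory Defs
  imports "HOL-Library.Cardinality" "Graph_Theory.Pair_Digraph" "Jordan_Normal_Form.Matrix"
begin

text \<open>
  Undirected simple graphs are represented as in the Graph Theory entry: an undirected edge
  between \<open>u\<close> and \<open>v\<close> is the pair of arcs \<open>(u, v)\<close> and \<open>(v, u)\<close>, and there are no loops.
  The degree of a vertex is then its out-degree.
\<close>

definition regular_graph :: "'v pair_pre_digraph \<Rightarrow> nat \<Rightarrow> bool" where
  "regular_graph G d \<longleftrightarrow> (\<forall>v \<in> pverts G. out_degree (with_proj G) v = d)"

definition semi_regular_graph :: "'v pair_pre_digraph \<Rightarrow> nat \<Rightarrow> nat \<Rightarrow> bool" where
  "semi_regular_graph G d1 d2 \<longleftrightarrow>
     d1 \<noteq> d2 \<and> out_degree (with_proj G) ` pverts G = {d1, d2}"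

definition TD :: "'a::comm_ring_1 itself \<Rightarrow> nat \<Rightarrow> 'a vec pair_pre_digraph" where
  "TD R n =
     \<lparr> pverts = carrier_vec n - {0\<^sub>v n},
       parcs = {(x, y). x \<in> carrier_vec n - {0\<^sub>v n} \<and> y \<in> carrier_vec n - {0\<^sub>v n} \<and>
                        x \<noteq> y \<and> x \<bullet> y = 0} \<rparr>"

lemma pair_bidirected_digraph_TD: "pair_bidirected_digraph (TD R n)"
proof unfold_locales
  show "symmetric (with_proj (TD R n))"
    by (auto simp: symmetric_def TD_def sym_def comm_scalar_prod)
qed (auto simp: TD_def)

lemma finite_carrier_vec: "finite (carrier_vec n :: 'a::finite vec set)"
proof -
  have "carrier_vec n \<subseteq> vec_of_list ` {xs :: 'a list. set xs \<subseteq> UNIV \<and> length xs = n}"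
  proof
    fix v :: "'a vec"
    assume "v \<in> carrier_vec n"
    then have "list_of_vec v \<in> {xs. set xs \<subseteq> UNIV \<and> length xs = n}"
      by auto
    then show "v \<in> vec_of_list ` {xs :: 'a list. set xs \<subseteq> UNIV \<and> length xs = n}"
      by (metis image_eqI vec_list)
  qed
  then show ?thesis
    by (rule finite_subset) (intro finite_imageI finite_lists_length_eq finite)
qed

lemma pair_graph_TD: "pair_graph (TD (R :: 'a::{comm_ring_1, finite} itself) n)"
proof -
  interpret pair_bidirected_digraph "TD R n"
    by (rule pair_bidirected_digraph_TD)
  have fin: "finite (pverts (TD R n))"
    by (simp add: TD_def finite_carrier_vec)
  have "parcs (TD R n) \<subseteq> pverts (TD R n) \<times> pverts (TD R n)"
    by (auto simp: TD_def)
  then have "finite (parcs (TD R n))"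
    by (rule finite_subset) (simp add: fin)
  with fin show ?thesis
    by unfold_locales
qed

lemma out_degree_eq_card_neighbours:
  "out_degree (with_proj G) v = card {w. (v, w) \<in> parcs G}"
proof -
  have "out_arcs (with_proj G) v = Pair v ` {w. (v, w) \<in> parcs G}"
    by (auto simp: out_arcs_def)
  then show ?thesis
    by (simp add: out_degree_def card_image inj_on_def)
qed

end

theory Submission
  imports Defs
    "HOL-Number_Theory.Residues"
    "Berlekamp_Zassenhaus.Berlekamp_Type_Based"
begin

text \<open>
  The neighbours of a vertex \<open>x\<close> are the vectors orthogonal to \<open>x\<close>, except the zero vector
  and except \<open>x\<close> itself when \<open>x\<close> is isotropic, that is, \<open>x \<bullet> x = 0\<close>. Since the standard
  bilinear form is non-degenerate, \<open>y \<mapsto> x \<bullet> y\<close> is a nonzero linear functional, so its kernel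
  has \<open>q ^ (n - 1)\<close> elements (\<open>card_orthogonal_vecs\<close>). Hence isotropic vertices have degree
  \<open>q ^ (n - 1) - 2\<close> and all others \<open>q ^ (n - 1) - 1\<close> (\<open>out_degree_TD\<close>). A unit vector is never
  isotropic, so for \<open>n \<ge> 2\<close> the only question is whether isotropic vertices exist.

  From dimension three on they always do, because \<open>- 1\<close> is a sum of two squares in every finite
  field (\<open>minus_one_sum_of_two_squares\<close>): if \<open>a\<^sup>2 + b\<^sup>2 = - 1\<close>, then \<open>(a, b, 1, 0, \<dots>, 0)\<close> is
  isotropic. In the plane, scaling an isotropic vector gives one of the form \<open>(i, 1)\<close> with
  \<open>i\<^sup>2 = - 1\<close>, so the question becomes whether \<open>- 1\<close> is a square. In characteristic 2 it is,
  as \<open>- 1 = 1\<close>; in odd characteristic the answer depends on \<open>q\<close> modulo 4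
  (\<open>minus_one_is_square\<close>, \<open>minus_one_not_square\<close>). In dimension one the form is the
  multiplication of a field, which has no zero divisors, so there are no edges.
\<close>

section \<open>Squares in a finite field\<close>

text \<open>
  Multiplication by \<open>x\<close> permutes the nonzero elements, so their product absorbs the factor
  \<open>x ^ (CARD('a) - 1)\<close>.
\<close>

lemma finite_field_fermat:
  fixes x :: "'a::{field, finite}"
  assumes "x \<noteq> 0"
  shows "x ^ (CARD('a) - 1) = 1"
proof -
  have "bij_betw ((*) x) (UNIV - {0}) (UNIV - {0})"
    by (rule bij_betwI[where g = "\<lambda>y. y / x"]) (use assms in auto)
  then have "(\<Prod>y\<in>UNIV - {0}. x * y) = (\<Prod>y\<in>UNIV - {0}. y)"
    by (rule prod.reindex_bij_betw)
  moreover have "(\<Prod>y\<in>UNIV - {0}. x * y) = x ^ (CARD('a) - 1) * (\<Prod>y\<in>UNIV - {0}. y)"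
    by (simp add: prod.distrib)
  moreover have "(\<Prod>y\<in>UNIV - {0}. y) \<noteq> (0 :: 'a)"
    by simp
  ultimately show ?thesis
    by simp
qed

text \<open>
  Write \<open>q = 4 k + 1\<close>. Every nonzero \<open>x\<close> satisfies \<open>(x ^ (2 k) - 1) (x ^ (2 k) + 1) = 0\<close>, but at
  most \<open>2 k\<close> of the \<open>4 k\<close> nonzero elements are roots of the first factor. Any other \<open>x\<close> gives
  the square root \<open>x ^ k\<close> of \<open>- 1\<close>.
\<close>

lemma minus_one_is_square:
  assumes "CARD('a::{field, finite}) mod 4 = 1"
  obtains i :: "'a::{field, finite}" where "i * i = - 1"
proof -
  obtain k where q: "CARD('a) = 4 * k + 1"
    using assms by (metis div_mult_mod_eq mult.commute)
  have "card {0 :: 'a, 1} \<le> CARD('a)"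
    by (intro card_mono) auto
  with q have "k > 0"
    by (cases k) auto
  define p where "p = monom (1 :: 'a) (2 * k) - 1"
  have deg: "degree p = 2 * k"
    using \<open>k > 0\<close> unfolding p_def
    by (subst diff_conv_add_uminus, subst degree_add_eq_left) (auto simp: degree_monom_eq)
  then have "p \<noteq> 0"
    using \<open>k > 0\<close> by auto
  then have "card {x. poly p x = 0} \<le> 2 * k"
    using card_poly_roots_bound[of p] deg by simp
  moreover have "card (UNIV - {0 :: 'a}) = 4 * k"
    using q by simp
  ultimately have "\<not> UNIV - {0} \<subseteq> {x. poly p x = 0}"
    using card_mono[of "{x. poly p x = 0}" "UNIV - {0}"] \<open>k > 0\<close> by auto
  then obtain x where "x \<noteq> 0" "poly p x \<noteq> 0"
    by blast
  then have x: "x \<noteq> 0" "x ^ (2 * k) \<noteq> 1"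
    by (simp_all add: p_def poly_monom)
  have "(x ^ (2 * k) - 1) * (x ^ (2 * k) + 1) = x ^ (CARD('a) - 1) - 1"
    by (simp add: q algebra_simps flip: power_add)
  also have "\<dots> = 0"
    using finite_field_fermat[OF x(1)] by simp
  finally have "x ^ (2 * k) = - 1"
    using x(2) by (simp add: eq_neg_iff_add_eq_0)
  then have "x ^ k * x ^ k = - 1"
    by (simp add: mult_2 power_add)
  then show thesis
    by (rule that)
qed

text \<open>
  If \<open>i\<^sup>2 = - 1\<close> and \<open>q = 4 k + 3\<close>, then \<open>1 = i ^ (q - 1) = i ^ (4 k + 2) = - 1\<close>. This forces
  characteristic 2, hence even \<open>q\<close>, which is absurd.
\<close>

lemma minus_one_not_square:
  fixes i :: "'a::{field, finite}"
  assumes "CARD('a) mod 4 = 3"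
  shows "i * i \<noteq> - 1"
proof
  assume i: "i * i = - 1"
  obtain k where q: "CARD('a) = 4 * k + 3"
    using assms by (metis div_mult_mod_eq mult.commute)
  have "i ^ 4 = 1"
    using i by (simp add: numeral_eq_Suc flip: mult.assoc)
  then have "i ^ (CARD('a) - 1) = - 1"
    by (simp add: q power_add power_mult i power2_eq_square)
  moreover have "i \<noteq> 0"
    using i by auto
  ultimately have "1 + 1 = (0 :: 'a)"
    using finite_field_fermat[of i] by simp
  then have "of_nat 2 = (0 :: 'a)"
    by simp
  then have "CHAR('a) dvd 2"
    by (simp only: of_nat_eq_0_iff_char_dvd)
  then have "CHAR('a) = 2"
    by (metis CHAR_not_1 One_nat_def prime_nat_iff two_is_prime_nat)
  then have "2 dvd CARD('a)"
    using CHAR_dvd_CARD[where ?'a = 'a] by simp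
  then show False
    using q by presburger
qed

text \<open>
  More than half of the field elements are squares, since \<open>0\<close> has one square root and every other
  square has at most two. So the set \<open>S\<close> of squares must meet its translated reflection
  \<open>T = - 1 - S\<close>. The argument covers characteristic 2 as well.
\<close>

lemma minus_one_sum_of_two_squares:
  obtains a b :: "'a::{field, finite}" where "a * a + b * b = - 1"
proof -
  define S where "S = range (\<lambda>x :: 'a. x * x)"
  define T where "T = (\<lambda>s. - 1 - s) ` S"
  have "UNIV = {0} \<union> (\<Union>s\<in>S - {0}. {x :: 'a. x * x = s})"
    by (auto simp: S_def)
  then have "CARD('a) \<le> card {0 :: 'a} + card (\<Union>s\<in>S - {0}. {x :: 'a. x * x = s})"
    by (metis card_Un_le)
  also have "\<dots> \<le> 1 + (\<Sum>s\<in>S - {0}. card {x :: 'a. x * x = s})"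
    using card_UN_le[of "S - {0}" "\<lambda>s. {x :: 'a. x * x = s}"] by simp
  also have "\<dots> \<le> 1 + (\<Sum>s\<in>S - {0}. 2)"
  proof (intro add_left_mono sum_mono)
    fix s assume "s \<in> S - {0}"
    then obtain r where "s = r * r"
      by (auto simp: S_def)
    then have "{x. x * x = s} \<subseteq> {r, - r}"
      by (auto simp: square_eq_iff)
    then have "card {x. x * x = s} \<le> card {r, - r}"
      by (intro card_mono) auto
    also have "\<dots> \<le> 2"
      by (simp add: card_insert_if)
    finally show "card {x. x * x = s} \<le> 2" .
  qed
  also have "\<dots> = 2 * card S - 1"
  proof -
    have "0 \<in> S"
      by (auto simp: S_def image_iff)
    moreover from this have "card S > 0"
      by (auto simp: card_gt_0_iff)
    ultimately show ?thesis
      by simp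
  qed
  finally have le: "CARD('a) < 2 * card S"
    using zero_less_card_finite[where ?'a = 'a] by linarith
  have card_T: "card T = card S"
    unfolding T_def by (intro card_image) (auto simp: inj_on_def)
  have "S \<inter> T \<noteq> {}"
  proof
    assume "S \<inter> T = {}"
    then have "card S + card T = card (S \<union> T)"
      by (simp add: card_Un_disjoint)
    also have "\<dots> \<le> CARD('a)"
      by (intro card_mono) auto
    finally show False
      using le card_T by simp
  qed
  then obtain a b :: 'a where "a * a = - 1 - b * b"
    unfolding S_def T_def by blast
  then show thesis
    by (intro that[of a b]) (simp add: algebra_simps)
qed

section \<open>Isotropic vectors and degrees\<close>

text \<open>
  The fibres of \<open>y \<mapsto> x \<bullet> y\<close> partition the space into \<open>CARD('a)\<close> sets. All have the size of
  the kernel, because a fibre is the translate of the kernel by any of its elements, and none is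
  empty as \<open>x\<close> has a nonzero coordinate.
\<close>

lemma card_orthogonal_vecs:
  fixes x :: "'a::{field, finite} vec"
  assumes x: "x \<in> carrier_vec n" "x \<noteq> 0\<^sub>v n"
  shows "card {y \<in> carrier_vec n. x \<bullet> y = 0} = CARD('a) ^ (n - 1)"
proof -
  define fib where "fib c = {y \<in> carrier_vec n. x \<bullet> y = c}" for c
  obtain j where j: "j < n" "x $ j \<noteq> 0"
    using x by (metis carrier_vecD eq_vecI index_zero_vec)
  have same_card: "card (fib c) = card (fib 0)" for c
  proof -
    define u where "u = (c / x $ j) \<cdot>\<^sub>v unit_vec n j"
    have u: "u \<in> carrier_vec n" "x \<bullet> u = c"
      using x j by (auto simp: u_def)
    have "bij_betw (\<lambda>y. y + u) (fib 0) (fib c)"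
    proof (rule bij_betwI[where g = "\<lambda>y. y - u"])
      show "(\<lambda>y. y + u) \<in> fib 0 \<rightarrow> fib c"
        using x(1) u by (auto simp: fib_def scalar_prod_add_distrib[of x n])
      show "(\<lambda>y. y - u) \<in> fib c \<rightarrow> fib 0"
        using x(1) u by (auto simp: fib_def scalar_prod_minus_distrib[of x n])
    qed (use u(1) in \<open>auto simp: fib_def intro!: eq_vecI\<close>)
    then show ?thesis
      by (simp add: bij_betw_same_card)
  qed
  have "CARD('a) * card (fib 0) = (\<Sum>c\<in>(UNIV :: 'a set). card (fib 0))"
    by simp
  also have "\<dots> = (\<Sum>c\<in>UNIV. card (fib c))"
    by (rule sum.cong[OF refl same_card[symmetric]])
  also have "\<dots> = card (\<Union>c\<in>UNIV. fib c)"
    by (rule card_UN_disjoint[symmetric]) (auto simp: fib_def)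
  also have "(\<Union>c\<in>UNIV. fib c) = carrier_vec n"
    by (auto simp: fib_def)
  also have "card \<dots> = CARD('a) * CARD('a) ^ (n - 1)"
    using j(1) by (simp add: card_carrier_vec power_eq_if)
  finally show ?thesis
    by (simp add: fib_def)
qed

lemma out_degree_TD:
  fixes x :: "'a::{field, finite} vec" and F :: "'a itself"
  assumes x: "x \<in> pverts (TD F n)"
  shows "out_degree (with_proj (TD F n)) x =
           CARD('a) ^ (n - 1) - (if x \<bullet> x = 0 then 2 else 1)"
proof -
  have x': "x \<in> carrier_vec n" "x \<noteq> 0\<^sub>v n"
    using x by (auto simp: TD_def)
  have "{y. (x, y) \<in> parcs (TD F n)} =
      {y \<in> carrier_vec n. x \<bullet> y = 0} - (if x \<bullet> x = 0 then {0\<^sub>v n, x} else {0\<^sub>v n})"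
    using x' by (auto simp: TD_def)
  moreover have "card \<dots> = CARD('a) ^ (n - 1) - (if x \<bullet> x = 0 then 2 else 1)"
    using x' by (subst card_Diff_subset) (auto simp: card_orthogonal_vecs)
  ultimately show ?thesis
    by (simp add: out_degree_eq_card_neighbours)
qed

text \<open>
  An isotropic vector in a lower dimension \<open>m\<close> suffices, since padding with zeros preserves
  isotropy. It realises the smaller degree, and a unit vector realises the larger one. The
  hypothesis \<open>n \<ge> 2\<close> ensures \<open>q ^ (n - 1) \<ge> 2\<close>, without which truncated subtraction would make
  the two degrees equal.
\<close>

lemma semi_regular_TD_if_isotropic:
  fixes F :: "'a::{field, finite} itself" and v :: "'a vec"
  assumes v: "v \<in> carrier_vec m" "v \<noteq> 0\<^sub>v m" "v \<bullet> v = 0" and "m \<le> n" "n \<ge> 2"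
  shows "semi_regular_graph (TD F n) (CARD('a) ^ (n - 1) - 1) (CARD('a) ^ (n - 1) - 2)"
proof -
  define w where "w = v @\<^sub>v 0\<^sub>v (n - m)"
  define e where "e = (unit_vec n 0 :: 'a vec)"
  have "w \<in> carrier_vec n"
    using v(1) \<open>m \<le> n\<close> by (metis append_carrier_vec le_add_diff_inverse w_def zero_carrier_vec)
  moreover have "w \<noteq> 0\<^sub>v n"
  proof
    assume "w = 0\<^sub>v n"
    also have "0\<^sub>v n = 0\<^sub>v m @\<^sub>v (0\<^sub>v (n - m) :: 'a vec)"
      using \<open>m \<le> n\<close> by (intro eq_vecI) (auto simp: append_vec_def Let_def)
    finally show False
      using v(1,2) unfolding w_def by (subst (asm) append_vec_eq[of _ m]) auto
  qed
  moreover have "w \<bullet> w = 0"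
    using v(1,3) unfolding w_def by (subst scalar_prod_append[of _ m _ "n - m"]) auto
  moreover have "e \<in> carrier_vec n" "e \<bullet> e = 1"
    using \<open>n \<ge> 2\<close> by (auto simp: e_def)
  moreover from this have "e \<noteq> 0\<^sub>v n"
    by auto
  ultimately have verts: "w \<in> pverts (TD F n)" "e \<in> pverts (TD F n)" and "w \<bullet> w = 0" "e \<bullet> e = 1"
    by (auto simp: TD_def)
  have "card {0 :: 'a, 1} \<le> CARD('a)"
    by (intro card_mono) auto
  then have "2 \<le> CARD('a)"
    by simp
  also have "\<dots> \<le> CARD('a) ^ (n - 1)"
    using \<open>n \<ge> 2\<close> by (intro self_le_power) (auto simp: Suc_le_eq)
  finally have "CARD('a) ^ (n - 1) - 1 \<noteq> CARD('a) ^ (n - 1) - 2"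
    by simp
  moreover have "out_degree (with_proj (TD F n)) ` pverts (TD F n) =
      {CARD('a) ^ (n - 1) - 1, CARD('a) ^ (n - 1) - 2}" (is "?deg ` _ = _")
  proof
    show "?deg ` pverts (TD F n) \<subseteq> {CARD('a) ^ (n - 1) - 1, CARD('a) ^ (n - 1) - 2}"
      by (auto simp: out_degree_TD)
    have "?deg e = CARD('a) ^ (n - 1) - 1" "?deg w = CARD('a) ^ (n - 1) - 2"
      using verts \<open>w \<bullet> w = 0\<close> \<open>e \<bullet> e = 1\<close> by (auto simp: out_degree_TD)
    then show "{CARD('a) ^ (n - 1) - 1, CARD('a) ^ (n - 1) - 2} \<subseteq> ?deg ` pverts (TD F n)"
      using verts by (metis empty_subsetI image_eqI insert_subset)
  qed
  ultimately show ?thesis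
    by (simp add: semi_regular_graph_def)
qed

lemma semi_regular_TD_ge_3:
  fixes F :: "'a::{field, finite} itself"
  assumes "n \<ge> 3"
  shows "semi_regular_graph (TD F n) (CARD('a) ^ (n - 1) - 1) (CARD('a) ^ (n - 1) - 2)"
proof -
  obtain a b :: 'a where ab: "a * a + b * b = - 1"
    by (rule minus_one_sum_of_two_squares)
  show ?thesis
  proof (rule semi_regular_TD_if_isotropic[of "vec_of_list [a, b, 1]" 3])
    show "vec_of_list [a, b, 1] \<noteq> 0\<^sub>v 3"
      by (simp add: numeral_eq_Suc zero_vec_Suc)
    show "vec_of_list [a, b, 1] \<bullet> vec_of_list [a, b, 1] = 0"
      using ab by (simp flip: add.assoc)
  qed (use assms in \<open>auto simp: numeral_eq_Suc\<close>)
qed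

lemma semi_regular_TD_2:
  fixes F :: "'a::{field, finite} itself" and i :: 'a
  assumes "i * i = - 1"
  shows "semi_regular_graph (TD F 2) (CARD('a) - 1) (CARD('a) - 2)"
proof -
  have "semi_regular_graph (TD F 2) (CARD('a) ^ (2 - 1) - 1) (CARD('a) ^ (2 - 1) - 2)"
  proof (rule semi_regular_TD_if_isotropic[of "vec_of_list [i, 1]" 2])
    show "vec_of_list [i, 1] \<noteq> 0\<^sub>v 2"
      by (simp add: numeral_eq_Suc zero_vec_Suc)
    show "vec_of_list [i, 1] \<bullet> vec_of_list [i, 1] = 0"
      using assms by simp
  qed (auto simp: numeral_eq_Suc)
  then show ?thesis
    by simp
qed

text \<open>
  If \<open>x\<^sub>0\<^sup>2 + x\<^sub>1\<^sup>2 = 0\<close> with \<open>x\<^sub>1 \<noteq> 0\<close>, then \<open>x\<^sub>0 / x\<^sub>1\<close> would be a square root of \<open>- 1\<close>.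
\<close>

lemma anisotropic_plane:
  fixes x :: "'a::{field, finite} vec"
  assumes "CARD('a) mod 4 = 3" "x \<in> carrier_vec 2" "x \<bullet> x = 0"
  shows "x = 0\<^sub>v 2"
proof -
  have sum0: "x $ 0 * x $ 0 + x $ 1 * x $ 1 = 0"
    using assms(2,3) by (simp add: scalar_prod_def numeral_eq_Suc)
  have "x $ 1 = 0"
  proof (rule ccontr)
    assume "x $ 1 \<noteq> 0"
    then have "(x $ 0 / x $ 1) * (x $ 0 / x $ 1) = - 1"
      using sum0 by (simp add: divide_simps eq_neg_iff_add_eq_0)
    then show False
      using minus_one_not_square[OF assms(1)] by blast
  qed
  with sum0 have "x $ 0 = 0"
    by simp
  with \<open>x $ 1 = 0\<close> show ?thesis
    using assms(2) by (intro eq_vecI) (auto simp: less_2_cases_iff)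
qed

theorem corollary2p4:
  fixes F :: "'a::{field, finite} itself" and n q :: nat
  assumes "CARD('a) = q" and "n \<ge> 1"
  shows "(n > 2 \<longrightarrow> semi_regular_graph (TD F n) (q ^ (n - 1) - 1) (q ^ (n - 1) - 2)) \<and>
         (n = 2 \<and> q mod 4 = 3 \<longrightarrow> regular_graph (TD F n) (q - 1)) \<and>
         (n = 2 \<and> q mod 4 = 1 \<longrightarrow> semi_regular_graph (TD F n) (q - 1) (q - 2)) \<and>
         (n = 2 \<and> CHAR('a) = 2 \<longrightarrow> semi_regular_graph (TD F n) (q - 1) (q - 2)) \<and>
         (n = 1 \<longrightarrow> parcs (TD F n) = {} \<and> card (pverts (TD F n)) = q - 1)"
proof (intro conjI impI; (elim conjE)?)
  note q = assms(1)
  show "semi_regular_graph (TD F n) (q ^ (n - 1) - 1) (q ^ (n - 1) - 2)" if "n > 2"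
    using semi_regular_TD_ge_3[of n F] that q by simp
  show "regular_graph (TD F n) (q - 1)" if "n = 2" "q mod 4 = 3"
    unfolding regular_graph_def
  proof
    fix x assume x: "x \<in> pverts (TD F n)"
    then have "x \<bullet> x \<noteq> 0"
      using anisotropic_plane[of x] that q by (auto simp: TD_def)
    then show "out_degree (with_proj (TD F n)) x = q - 1"
      using out_degree_TD[OF x] that q by simp
  qed
  show "semi_regular_graph (TD F n) (q - 1) (q - 2)" if "n = 2" "q mod 4 = 1"
  proof -
    have "CARD('a) mod 4 = 1"
      using that q by simp
    then obtain i :: 'a where "i * i = - 1"
      by (rule minus_one_is_square)
    then show ?thesis
      using semi_regular_TD_2[of i F] that q by simp
  qed
  show "semi_regular_graph (TD F n) (q - 1) (q - 2)" if "n = 2" "CHAR('a) = 2"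
    using semi_regular_TD_2[of 1 F] uminus_CHAR_2[OF that(2), of 1] that q by simp
  show "parcs (TD F n) = {}" if "n = 1"
  proof -
    have False if "x \<in> carrier_vec 1" "y \<in> carrier_vec 1" "x \<noteq> 0\<^sub>v 1" "y \<noteq> 0\<^sub>v 1" "x \<bullet> y = 0"
      for x y :: "'a vec"
      using that by (auto simp: scalar_prod_def vec_eq_iff)
    then show ?thesis
      using \<open>n = 1\<close> by (auto simp: TD_def)
  qed
  show "card (pverts (TD F n)) = q - 1" if "n = 1"
    using that q by (simp add: TD_def card_Diff_subset card_carrier_vec)
qed

end
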